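(* Let $n,d\ge1$ be integers, let $\mathcal{T}\in\mathbb{C}^{n^{2d}}$ be a PS tensor, and let $\pi=(\pi_1,\dots,\pi_{2d})$ be a permutation of $\{1,\dots,2d\}$ satisfying $$\left\lfloor\frac d2\right\rfloor\le\left|\{\pi_1,\dots,\pi_d\}\cap\{1,\dots,d\}\right|\le\left\lceil\frac d2\right\rceil.$$ If $\operatorname{rank}(M_\pi(\mathcal{T}))=1$, then $\operatorname{rank}(\mathcal{T})=1$.
   Context: $\mathbb{C}^{n^{2d}}$ denotes the space of complex tensors of order $2d$ with every mode of dimension $n$. $\mathcal{T}\in\mathbb{C}^{n^{2d}}$ is partial-symmetric (PS) if its entries are invariant under any permutation of the first $d$ indices and under any permutation of the last $d$ indices. $\operatorname{rank}(\mathcal{T})$ is the smallest $r$ such that $\mathcal{T}=\sum_{j=1}^r\boldsymbol{a}_{j1}\otimes\dots\otimes\boldsymbol{a}_{j,2d}$ with $\boldsymbol{a}_{jk}\in\mathbb{C}^n$. For $1\le i_1,\dots,i_d\le n$ put $n(i_1\dots i_d):=\sum_{k=1}^d(i_k-1)n^{d-k}+1\in\{1,\dots,n^d\}$. For a permutation $\pi$ of $\{1,\dots,2d\}$, the $\pi$-matricization $M_\pi(\mathcal{T})$ is the $n^d\times n^d$ matrix defined by $$M_\pi(\mathcal{T})_{n(i_{\pi_1}\dots i_{\pi_d})\,n(i_{\pi_{d+1}}\dots i_{\pi_{2d}})}=\mathcal{T}_{i_1\dots i_{2d}}\quad\text{for all }1\le i_1,\dots,i_{2d}\le n,$$ and its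 rank is the usual matrix rank. *)

theory Defs
  imports
    "HOL-Library.FuncSet"
    "HOL-Combinatorics.Permutations"
    "Jordan_Normal_Form.DL_Rank"
begin

text \<open>
  Multi-indices and tensor modes are counted from 1. A multi-index is a function on
  \<open>{1..m}\<close>, extended by \<^const>\<open>undefined\<close>; a tensor is a function on multi-indices, extended likewise,
  so that equality of tensors is entrywise equality.
\<close>

definition multi_indices :: "nat \<Rightarrow> nat \<Rightarrow> (nat \<Rightarrow> nat) set" where
  "multi_indices n m = {1..m} \<rightarrow>\<^sub>E {1..n}"

definition tensor_space :: "nat \<Rightarrow> nat \<Rightarrow> ((nat \<Rightarrow> nat) \<Rightarrow> complex) set" where
  "tensor_space n m = multi_indices n m \<rightarrow>\<^sub>E UNIV"

text \<open>
  A permutation \<open>\<sigma>\<close> of the modes sends \<open>(i\<^sub>1, \<dots>, i\<^sub>m)\<close> to \<open>i \<circ> \<sigma>\<close>; as \<open>\<sigma>\<close> fixes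
  everything outside \<open>{1..m}\<close>, this is again a multi-index.
\<close>

definition partial_symmetric :: "nat \<Rightarrow> nat \<Rightarrow> ((nat \<Rightarrow> nat) \<Rightarrow> complex) \<Rightarrow> bool" where
  "partial_symmetric n d T \<longleftrightarrow>
     (\<forall>\<sigma>. \<sigma> permutes {1..d} \<longrightarrow> (\<forall>i\<in>multi_indices n (2 * d). T (i \<circ> \<sigma>) = T i)) \<and>
     (\<forall>\<sigma>. \<sigma> permutes {d + 1..2 * d} \<longrightarrow> (\<forall>i\<in>multi_indices n (2 * d). T (i \<circ> \<sigma>) = T i))"

text \<open>
  The entries of \<^typ>\<open>complex vec\<close> are counted from 0, hence the shift by 1.
\<close>

definition outer_product :: "nat \<Rightarrow> nat \<Rightarrow> (nat \<Rightarrow> complex vec) \<Rightarrow> (nat \<Rightarrow> nat) \<Rightarrow> complex" where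
  "outer_product n m a = (\<lambda>i\<in>multi_indices n m. \<Prod>k=1..m. a k $ (i k - 1))"

definition is_sum_of_outer_products :: "nat \<Rightarrow> nat \<Rightarrow> nat \<Rightarrow> ((nat \<Rightarrow> nat) \<Rightarrow> complex) \<Rightarrow> bool" where
  "is_sum_of_outer_products n m r T \<longleftrightarrow>
     (\<exists>a :: nat \<Rightarrow> nat \<Rightarrow> complex vec.
        (\<forall>j\<in>{1..r}. \<forall>k\<in>{1..m}. a j k \<in> carrier_vec n) \<and>
        T = (\<lambda>i\<in>multi_indices n m. \<Sum>j=1..r. outer_product n m (a j) i))"

definition tensor_rank :: "nat \<Rightarrow> nat \<Rightarrow> ((nat \<Rightarrow> nat) \<Rightarrow> complex) \<Rightarrow> nat" where
  "tensor_rank n m T = (LEAST r. is_sum_of_outer_products n m r T)"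

definition lin_index :: "nat \<Rightarrow> nat \<Rightarrow> (nat \<Rightarrow> nat) \<Rightarrow> nat" where
  "lin_index n d i = (\<Sum>k=1..d. (i k - 1) * n ^ (d - k)) + 1"

text \<open>
  Matrix rows and columns are counted from 0, whereas \<open>lin_index\<close> counts from 1. If \<open>\<pi>\<close> permutes \<open>{1..2 * d}\<close>, the
  multi-index in the definition exists and is unique; the matrix is the one characterised by
  the lemmas \<open>matricization_entry\<close> and \<open>matricization_unique\<close> below.
\<close>

definition matricization ::
    "nat \<Rightarrow> nat \<Rightarrow> (nat \<Rightarrow> nat) \<Rightarrow> ((nat \<Rightarrow> nat) \<Rightarrow> complex) \<Rightarrow> complex mat" where
  "matricization n d \<pi> T =
     mat (n ^ d) (n ^ d) (\<lambda>(r, c). T (THE i. i \<in> multi_indices n (2 * d) \<and>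
       lin_index n d (\<lambda>k. i (\<pi> k)) = r + 1 \<and> lin_index n d (\<lambda>k. i (\<pi> (d + k))) = c + 1))"

definition mat_rank :: "complex mat \<Rightarrow> nat" where
  "mat_rank A = vec_space.rank (dim_row A) A"

lemma matricization_carrier: "matricization n d \<pi> T \<in> carrier_mat (n ^ d) (n ^ d)"
  by (simp add: matricization_def)

lemma lin_index_Suc:
  "lin_index n (Suc d) i = n * (lin_index n d i - 1) + (i (Suc d) - 1) + 1"
proof -
  have "(\<Sum>k=1..d. (i k - 1) * n ^ (Suc d - k)) = (\<Sum>k=1..d. n * ((i k - 1) * n ^ (d - k)))"
    by (rule sum.cong) (auto simp: Suc_diff_le)
  then show ?thesis
    by (simp add: lin_index_def sum_distrib_left)
qed

lemma lin_index_le: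
  assumes "\<And>k. k \<in> {1..d} \<Longrightarrow> i k \<in> {1..n}"
  shows "lin_index n d i \<le> n ^ d"
  using assms
proof (induction d)
  case 0
  then show ?case by (simp add: lin_index_def)
next
  case (Suc d)
  have "lin_index n d i \<le> n ^ d" by (rule Suc.IH) (use Suc.prems in auto)
  then have "n * (lin_index n d i - 1) + n \<le> n * n ^ d"
    by (metis Suc_le_eq add.commute add_diff_inverse_nat lin_index_def mult_Suc_right
        mult_le_mono2 not_add_less2 plus_1_eq_Suc)
  moreover have "i (Suc d) \<in> {1..n}" using Suc.prems by simp
  ultimately show ?case by (auto simp: lin_index_Suc)
qed

lemma lin_index_inj:
  assumes "\<And>k. k \<in> {1..d} \<Longrightarrow> i k \<in> {1..n}" "\<And>k. k \<in> {1..d} \<Longrightarrow> j k \<in> {1..n}"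
    and "lin_index n d i = lin_index n d j" "k \<in> {1..d}"
  shows "i k = j k"
  using assms
proof (induction d arbitrary: k)
  case 0
  then show ?case by simp
next
  case (Suc d)
  have b: "i (Suc d) \<in> {1..n}" "j (Suc d) \<in> {1..n}" using Suc.prems(1,2) by simp_all
  have e: "n * (lin_index n d i - 1) + (i (Suc d) - 1) = n * (lin_index n d j - 1) + (j (Suc d) - 1)"
    using Suc.prems(3) by (simp add: lin_index_Suc)
  have lt: "i (Suc d) - 1 < n" "j (Suc d) - 1 < n" using b by auto
  have "(n * (lin_index n d i - 1) + (i (Suc d) - 1)) mod n = i (Suc d) - 1"
    "(n * (lin_index n d j - 1) + (j (Suc d) - 1)) mod n = j (Suc d) - 1"
    using lt by (metis mod_mult_self4 mod_less)+
  with e have last: "i (Suc d) - 1 = j (Suc d) - 1" by simp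
  with e lt have "lin_index n d i - 1 = lin_index n d j - 1" by simp
  then have "lin_index n d i = lin_index n d j" by (simp add: lin_index_def)
  then have "i k = j k" if "k \<in> {1..d}" for k
    using Suc.IH[OF _ _ _ that] Suc.prems(1,2) by simp
  moreover have "i (Suc d) = j (Suc d)" using last b by auto
  ultimately show ?case using Suc.prems(4) by (cases "k = Suc d") auto
qed

lemma lin_index_surj:
  assumes "r < n ^ d"
  shows "\<exists>i. (\<forall>k\<in>{1..d}. i k \<in> {1..n}) \<and> lin_index n d i = r + 1"
  using assms
proof (induction d arbitrary: r)
  case 0
  then show ?case by (simp add: lin_index_def)
next
  case (Suc d)
  then have n: "n > 0" by (cases n) auto
  have "r div n < n ^ d" using Suc.prems n by (simp add: less_mult_imp_div_less mult.commute)
  then obtain i where i: "\<forall>k\<in>{1..d}. i k \<in> {1..n}" "lin_index n d i = r div n + 1"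
    using Suc.IH by blast
  let ?i = "i(Suc d := r mod n + 1)"
  have "lin_index n d ?i = lin_index n d i" by (simp add: lin_index_def)
  then have "lin_index n (Suc d) ?i = r + 1" using i(2) by (simp add: lin_index_Suc)
  moreover have "\<forall>k\<in>{1..Suc d}. ?i k \<in> {1..n}" using i(1) n by (auto simp: Suc_leI)
  ultimately show ?case by blast
qed

lemma multi_index_eqI:
  assumes \<pi>: "\<pi> permutes {1..2 * d}"
    and i: "i \<in> multi_indices n (2 * d)" and j: "j \<in> multi_indices n (2 * d)"
    and r: "lin_index n d (\<lambda>k. i (\<pi> k)) = lin_index n d (\<lambda>k. j (\<pi> k))"
    and c: "lin_index n d (\<lambda>k. i (\<pi> (d + k))) = lin_index n d (\<lambda>k. j (\<pi> (d + k)))"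
  shows "i = j"
proof (rule PiE_ext[OF i[unfolded multi_indices_def] j[unfolded multi_indices_def]])
  fix l assume l: "l \<in> {1..2 * d}"
  have b: "i (\<pi> k) \<in> {1..n}" "j (\<pi> k) \<in> {1..n}" if "k \<in> {1..2 * d}" for k
    using i j permutes_in_image[OF \<pi>, of k] that unfolding multi_indices_def by blast+
  have b': "i (\<pi> k) \<in> {1..n}" "j (\<pi> k) \<in> {1..n}" "i (\<pi> (d + k)) \<in> {1..n}" "j (\<pi> (d + k)) \<in> {1..n}"
    if "k \<in> {1..d}" for k
    using b[of k] b[of "d + k"] that by auto
  obtain k where k: "k \<in> {1..2 * d}" "l = \<pi> k"
    using l permutes_image[OF \<pi>] by blast
  show "i l = j l"
  proof (cases "k \<le> d")
    case True
    then show ?thesis using lin_index_inj[OF b'(1,2) r] k by simp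
  next
    case False
    then have kd: "k - d \<in> {1..d}" "d + (k - d) = k" using k(1) by auto
    have "i (\<pi> (d + (k - d))) = j (\<pi> (d + (k - d)))"
      using lin_index_inj[OF b'(3,4) c kd(1)] by simp
    then show ?thesis using kd(2) k(2) by simp
  qed
qed

lemma multi_index_lin_bounds:
  assumes \<pi>: "\<pi> permutes {1..2 * d}" and i: "i \<in> multi_indices n (2 * d)"
  shows "lin_index n d (\<lambda>k. i (\<pi> k)) \<in> {1..n ^ d}"
    and "lin_index n d (\<lambda>k. i (\<pi> (d + k))) \<in> {1..n ^ d}"
proof -
  have b: "i (\<pi> k) \<in> {1..n}" if "k \<in> {1..2 * d}" for k
    using i permutes_in_image[OF \<pi>, of k] that unfolding multi_indices_def by blast
  have "lin_index n d (\<lambda>k. i (\<pi> k)) \<le> n ^ d" "lin_index n d (\<lambda>k. i (\<pi> (d + k))) \<le> n ^ d"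
    by (rule lin_index_le, rule b, simp)+
  then show "lin_index n d (\<lambda>k. i (\<pi> k)) \<in> {1..n ^ d}"
    and "lin_index n d (\<lambda>k. i (\<pi> (d + k))) \<in> {1..n ^ d}"
    by (simp_all add: lin_index_def)
qed

lemma matricization_entry:
  assumes \<pi>: "\<pi> permutes {1..2 * d}" and i: "i \<in> multi_indices n (2 * d)"
  shows "matricization n d \<pi> T $$
    (lin_index n d (\<lambda>k. i (\<pi> k)) - 1, lin_index n d (\<lambda>k. i (\<pi> (d + k))) - 1) = T i"
proof -
  have "(THE j. j \<in> multi_indices n (2 * d) \<and>
       lin_index n d (\<lambda>k. j (\<pi> k)) = lin_index n d (\<lambda>k. i (\<pi> k)) \<and>
       lin_index n d (\<lambda>k. j (\<pi> (d + k))) = lin_index n d (\<lambda>k. i (\<pi> (d + k)))) = i"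
    using i multi_index_eqI[OF \<pi> _ i] by (intro the_equality) blast+
  moreover have "lin_index n d (\<lambda>k. i (\<pi> k)) - 1 < n ^ d" "lin_index n d (\<lambda>k. i (\<pi> k)) - 1 + 1 = lin_index n d (\<lambda>k. i (\<pi> k))"
    "lin_index n d (\<lambda>k. i (\<pi> (d + k))) - 1 < n ^ d" "lin_index n d (\<lambda>k. i (\<pi> (d + k))) - 1 + 1 = lin_index n d (\<lambda>k. i (\<pi> (d + k)))"
    using multi_index_lin_bounds[OF \<pi> i] by auto
  ultimately show ?thesis by (simp only: matricization_def index_mat prod.case)
qed

lemma multi_index_exists:
  assumes \<pi>: "\<pi> permutes {1..2 * d}" and rc: "r < n ^ d" "c < n ^ d"
  shows "\<exists>i\<in>multi_indices n (2 * d).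
    lin_index n d (\<lambda>k. i (\<pi> k)) = r + 1 \<and> lin_index n d (\<lambda>k. i (\<pi> (d + k))) = c + 1"
proof -
  obtain p where p: "\<forall>k\<in>{1..d}. p k \<in> {1..n}" "lin_index n d p = r + 1"
    using lin_index_surj[OF rc(1)] by blast
  obtain q where q: "\<forall>k\<in>{1..d}. q k \<in> {1..n}" "lin_index n d q = c + 1"
    using lin_index_surj[OF rc(2)] by blast
  define g where "g k = (if k \<le> d then p k else q (k - d))" for k
  define i where "i = restrict (g \<circ> inv_into UNIV \<pi>) {1..2 * d}"
  have g: "g k \<in> {1..n}" if "k \<in> {1..2 * d}" for k
  proof (cases "k \<le> d")
    case False
    then have "k - d \<in> {1..d}" using that by auto
    with False q(1) show ?thesis by (simp add: g_def)
  qed (use that p(1) in \<open>auto simp: g_def\<close>)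
  have i\<pi>: "i (\<pi> k) = g k" if "k \<in> {1..2 * d}" for k
    using that permutes_in_image[OF \<pi>, of k] permutes_inverses(2)[OF \<pi>]
    unfolding i_def by simp
  have "inv_into UNIV \<pi> l \<in> {1..2 * d}" if "l \<in> {1..2 * d}" for l
    using that permutes_in_image[OF permutes_inv[OF \<pi>], of l] by blast
  then have "i \<in> multi_indices n (2 * d)"
    unfolding multi_indices_def i_def using g by (intro restrict_PiE_iff[THEN iffD2]) simp
  moreover have "lin_index n d (\<lambda>k. i (\<pi> k)) = lin_index n d p"
    unfolding lin_index_def using i\<pi> by (auto simp: g_def intro!: sum.cong)
  moreover have "lin_index n d (\<lambda>k. i (\<pi> (d + k))) = lin_index n d q"
    unfolding lin_index_def using i\<pi> by (auto simp: g_def intro!: sum.cong)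
  ultimately show ?thesis using p(2) q(2) by metis
qed

lemma matricization_unique:
  assumes \<pi>: "\<pi> permutes {1..2 * d}" and A: "A \<in> carrier_mat (n ^ d) (n ^ d)"
    and entry: "\<And>i. i \<in> multi_indices n (2 * d) \<Longrightarrow>
      A $$ (lin_index n d (\<lambda>k. i (\<pi> k)) - 1, lin_index n d (\<lambda>k. i (\<pi> (d + k))) - 1) = T i"
  shows "A = matricization n d \<pi> T"
proof (rule eq_matI)
  fix r c
  assume "r < dim_row (matricization n d \<pi> T)" "c < dim_col (matricization n d \<pi> T)"
  then have "r < n ^ d" "c < n ^ d" by (simp_all add: matricization_def)
  then obtain i where i: "i \<in> multi_indices n (2 * d)"
    "lin_index n d (\<lambda>k. i (\<pi> k)) = r + 1" "lin_index n d (\<lambda>k. i (\<pi> (d + k))) = c + 1"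
    using multi_index_exists[OF \<pi>] by blast
  then show "A $$ (r, c) = matricization n d \<pi> T $$ (r, c)"
    using entry[OF i(1)] matricization_entry[OF \<pi> i(1), of T] by simp
qed (use A in \<open>auto simp: matricization_def\<close>)

lemma ex_sum_of_outer_products:
  assumes "m \<ge> 1" and T: "T \<in> tensor_space n m"
  shows "\<exists>r. is_sum_of_outer_products n m r T"
proof -
  let ?I = "multi_indices n m"
  have fin: "finite ?I" unfolding multi_indices_def by (rule finite_PiE) auto
  obtain e where e: "bij_betw e {1..card ?I} ?I"
    using ex_bij_betw_nat_finite_1[OF fin] by blast
  define a where "a j k = vec n (\<lambda>l. (if k = 1 then T (e j) else 1) * (if e j k = l + 1 then 1 else 0))"
    for j k
  have *: "outer_product n m (a j) i = (if e j = i then T i else 0)"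
    if i: "i \<in> ?I" and j: "j \<in> {1..card ?I}" for i j
  proof -
    have ej: "e j \<in> ?I" using e j bij_betwE by blast
    have ib: "i k \<in> {1..n}" if "k \<in> {1..m}" for k
      using i that unfolding multi_indices_def by blast
    have "outer_product n m (a j) i
        = (\<Prod>k=1..m. (if k = 1 then T (e j) else 1) * (if e j k = i k then 1 else 0))"
      unfolding outer_product_def restrict_apply'[OF i]
      using ib by (intro prod.cong refl) (force simp: a_def)
    also have "\<dots> = (\<Prod>k=1..m. if k = 1 then T (e j) else 1) * (\<Prod>k=1..m. if e j k = i k then 1 else 0)"
      by (rule prod.distrib)
    also have "(\<Prod>k=1..m. if k = 1 then T (e j) else 1) = T (e j)"
      using assms(1) by (simp add: prod.delta)
    also have "(\<Prod>k=1..m. if e j k = i k then 1 else 0) = (if e j = i then 1 else (0::complex))"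
    proof (cases "e j = i")
      case False
      then obtain k where "k \<in> {1..m}" "e j k \<noteq> i k"
        using PiE_ext ej i unfolding multi_indices_def by metis
      then have "(\<Prod>k=1..m. if e j k = i k then 1 else (0::complex)) = 0"
        by (intro prod_zero) auto
      with False show ?thesis by simp
    qed simp
    finally show ?thesis by auto
  qed
  have "(\<Sum>j=1..card ?I. outer_product n m (a j) i) = T i" if i: "i \<in> ?I" for i
  proof -
    have "(\<Sum>j=1..card ?I. outer_product n m (a j) i) = (\<Sum>j=1..card ?I. if e j = i then T i else 0)"
      using *[OF i] by (intro sum.cong) auto
    also have "\<dots> = (\<Sum>x\<in>?I. if x = i then T i else 0)"
      by (rule sum.reindex_bij_betw[OF e])
    also have "\<dots> = T i" using fin i by simp
    finally show ?thesis .
  qed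
  then have "T = (\<lambda>i\<in>?I. \<Sum>j=1..card ?I. outer_product n m (a j) i)"
    using T unfolding tensor_space_def by (intro extensionalityI[of T ?I]) (auto simp: PiE_def)
  then have "is_sum_of_outer_products n m (card ?I) T"
    unfolding is_sum_of_outer_products_def by (intro exI[of _ a]) (auto simp: a_def)
  then show ?thesis ..
qed

end

theory Submission
  imports Defs "Jordan_Normal_Form.DL_Rank_Submatrix"
begin

text \<open>
  Call a set \<open>S\<close> of modes exchangeable for \<open>T\<close> if \<open>T i * T j\<close> does not change when the coordinates of
  \<open>i\<close> and \<open>j\<close> in \<open>S\<close> are swapped. Vanishing of the \<open>2 \<times> 2\<close> minors of the matricization says that
  \<open>A = {\<pi>\<^sub>1, \<dots>, \<pi>\<^sub>d}\<close> is exchangeable. If \<open>d \<ge> 2\<close>, the condition on \<open>\<pi>\<close> only matters in that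
  each of the two blocks of symmetric modes contains some \<open>p \<in> A\<close> and some \<open>q \<notin> A\<close>. Conjugating
  the transposition of the modes \<open>p\<close>, \<open>q\<close> of \<open>i\<close> by the exchange of \<open>A\<close> gives the transposition of mode \<open>q\<close>
  of \<open>i\<close> with mode \<open>p\<close> of \<open>j\<close>; composing with symmetries shows that \<open>{q}\<close> is exchangeable, and then
  so is every single mode. A nonzero tensor all of whose single modes are exchangeable is an
  outer product.
\<close>

section \<open>Matrices of rank one\<close>

lemma det_2:
  fixes A :: "'a::comm_ring_1 mat"
  assumes A: "A \<in> carrier_mat 2 2"
  shows "det A = A $$ (0, 0) * A $$ (1, 1) - A $$ (0, 1) * A $$ (1, 0)"
proof -
  have "mat_delete A i j \<in> carrier_mat 1 1" for i j
    using mat_delete_carrier[OF A] by simp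
  then have "cofactor A 0 0 = A $$ (1, 1)" "cofactor A 0 1 = - A $$ (1, 0)"
    using A by (simp_all add: cofactor_def det_single mat_delete_def)
  then show ?thesis
    using laplace_expansion_row[OF A, of 0] by (simp add: numeral_2_eq_2)
qed

text \<open>A nonzero minor of order 2 would force rank at least 2. The indices may coincide and
  come in any order, so any two entries can be compared.\<close>

lemma (in vec_space) rank_le_1_minor_eq:
  assumes A: "A \<in> carrier_mat n nc" and rank: "rank A \<le> 1"
    and r: "r < n" "r' < n" and c: "c < nc" "c' < nc"
  shows "A $$ (r, c) * A $$ (r', c') = A $$ (r, c') * A $$ (r', c)"
proof -
  have ordered: "A $$ (r, c) * A $$ (r', c') = A $$ (r, c') * A $$ (r', c)"
    if rr: "r < r'" "r' < n" and cc: "c < c'" "c' < nc" for r r' c c'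
  proof -
    let ?B = "submatrix A {r, r'} {c, c'}"
    have "{j. j < nc \<and> j \<in> {c, c'}} = {c, c'}" "{i. i < n \<and> i \<in> {r, r'}} = {r, r'}"
      using rr cc by auto
    then have card: "card {j. j < nc \<and> j \<in> {c, c'}} = 2" "card {i. i < n \<and> i \<in> {r, r'}} = 2"
      using rr cc by simp_all
    have "det ?B = 0"
    proof (rule ccontr)
      assume "det ?B \<noteq> 0"
      then show False using rank_gt_minor[OF A] card rank by fastforce
    qed
    moreover have "?B \<in> carrier_mat 2 2"
      using A card by (intro carrier_matI) (simp_all add: dim_submatrix)
    ultimately have "?B $$ (0, 0) * ?B $$ (1, 1) - ?B $$ (0, 1) * ?B $$ (1, 0) = 0"
      by (simp add: det_2)
    \<comment> \<open>A submatrix keeps the order of its indices: entry \<open>(x, y)\<close> of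
      \<open>A\<close> lands at the numbers of selected rows below \<open>x\<close> and selected
      columns below \<open>y\<close>.\<close>
    moreover have "{a \<in> {r, r'}. a < r} = {}" "{a \<in> {r, r'}. a < r'} = {r}"
      "{a \<in> {c, c'}. a < c} = {}" "{a \<in> {c, c'}. a < c'} = {c}"
      using rr cc by auto
    then have pos: "card {a \<in> {r, r'}. a < r} = 0" "card {a \<in> {r, r'}. a < r'} = 1"
      "card {a \<in> {c, c'}. a < c} = 0" "card {a \<in> {c, c'}. a < c'} = 1"
      by (simp_all only: card.empty card_1_singleton_iff) auto
    have "?B $$ (card {a \<in> {r, r'}. a < x}, card {a \<in> {c, c'}. a < y}) = A $$ (x, y)"
      if "x \<in> {r, r'}" "y \<in> {c, c'}" for x y
      using A rr cc that by (intro submatrix_index_card) auto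
    from this[of r c] this[of r' c'] this[of r c'] this[of r' c]
    have "?B $$ (0, 0) = A $$ (r, c)" "?B $$ (1, 1) = A $$ (r', c')"
      "?B $$ (0, 1) = A $$ (r, c')" "?B $$ (1, 0) = A $$ (r', c)"
      unfolding pos by blast+
    ultimately show ?thesis by simp
  qed
  consider "r = r' \<or> c = c'" | "r < r'" "c < c'" | "r < r'" "c' < c"
    | "r' < r" "c < c'" | "r' < r" "c' < c"
    by linarith
  then show ?thesis
  proof cases
    case 1
    then show ?thesis by (auto simp only: mult.commute)
  next
    case 2
    then show ?thesis using ordered[of r r' c c'] r c by simp
  next
    case 3
    then show ?thesis using ordered[of r r' c' c] r c by simp
  next
    case 4
    then show ?thesis using ordered[of r' r c c'] r c by (simp only: mult.commute)
  next
    case 5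
    then show ?thesis using ordered[of r' r c' c] r c by (simp only: mult.commute)
  qed
qed

section \<open>Exchangeable sets of modes\<close>

lemma override_on_multi_indices:
  assumes "i \<in> multi_indices n m" "j \<in> multi_indices n m"
  shows "override_on i j S \<in> multi_indices n m"
  using assms by (auto simp: multi_indices_def override_on_def PiE_iff extensional_def)

lemma comp_permutes_multi_indices:
  assumes "\<sigma> permutes {1..m}" "i \<in> multi_indices n m"
  shows "i \<circ> \<sigma> \<in> multi_indices n m"
proof -
  have i: "i \<in> {1..m} \<rightarrow>\<^sub>E {1..n}" using assms(2) unfolding multi_indices_def .
  have "i (\<sigma> k) \<in> {1..n}" if "k \<in> {1..m}" for k
    using PiE_mem[OF i, of "\<sigma> k"] permutes_in_image[OF assms(1)] that by blast
  moreover have "i (\<sigma> k) = undefined" if "k \<notin> {1..m}" for k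
    using PiE_arb[OF i that] permutes_not_in[OF assms(1) that] by simp
  ultimately show ?thesis
    unfolding multi_indices_def PiE_iff extensional_def by simp
qed

text \<open>Over a field this says that the flattening of \<open>T\<close>, with rows indexed by the
  modes in \<open>S\<close> and columns by the other modes, has rank at most 1.\<close>

definition exchangeable ::
    "nat \<Rightarrow> nat \<Rightarrow> ((nat \<Rightarrow> nat) \<Rightarrow> 'a::comm_monoid_mult) \<Rightarrow> nat set \<Rightarrow> bool" where
  "exchangeable n m T S \<longleftrightarrow> (\<forall>i\<in>multi_indices n m. \<forall>j\<in>multi_indices n m.
     T i * T j = T (override_on i j S) * T (override_on j i S))"

text \<open>Exchanging the complement amounts to exchanging \<open>S\<close> and then swapping the
  two factors.\<close>

lemma exchangeable_complement:
  assumes "exchangeable n m T S"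
  shows "exchangeable n m T ({1..m} - S)"
  unfolding exchangeable_def
proof (intro ballI)
  fix i j assume i: "i \<in> multi_indices n m" and j: "j \<in> multi_indices n m"
  have "override_on i j ({1..m} - S) = override_on j i S"
    "override_on j i ({1..m} - S) = override_on i j S"
    using i j by (auto simp: fun_eq_iff override_on_def multi_indices_def PiE_iff extensional_def)
  then show "T i * T j
      = T (override_on i j ({1..m} - S)) * T (override_on j i ({1..m} - S))"
    using assms i j by (simp add: exchangeable_def mult.commute)
qed

lemma exchangeable_singleton:
  assumes S: "exchangeable n m T S" and pq: "p \<in> S" "q \<notin> S" "p \<in> {1..m}" "q \<in> {1..m}"
    and sym: "\<And>i. i \<in> multi_indices n m \<Longrightarrow> T (i \<circ> transpose p q) = T i"
  shows "exchangeable n m T {q}"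
  unfolding exchangeable_def
proof (intro ballI)
  let ?\<tau> = "transpose p q"
  fix i j assume i: "i \<in> multi_indices n m" and j: "j \<in> multi_indices n m"
  have \<tau>: "?\<tau> permutes {1..m}" using pq by (simp add: permutes_swap_id)
  note mi = comp_permutes_multi_indices[OF \<tau>] override_on_multi_indices
  \<comment> \<open>The entry \<open>j q\<close> travels to the other factor: \<open>?\<tau>\<close>
    moves it to mode \<open>p\<close> in \<open>S\<close>, the exchange of \<open>S\<close> carries
    it across, and \<open>?\<tau>\<close> puts it back in mode \<open>q\<close>, outside
    \<open>S\<close>. The second exchange returns the modes in \<open>S\<close>; a last
    \<open>?\<tau>\<close> repairs modes \<open>p\<close> and \<open>q\<close> of
    \<open>j4\<close>.\<close>
  define j1 where "j1 = j \<circ> ?\<tau>"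
  define i2 where "i2 = override_on i j1 S"
  define j2 where "j2 = override_on j1 i S"
  define i3 where "i3 = i2 \<circ> ?\<tau>"
  define i4 where "i4 = override_on i3 j2 S"
  define j4 where "j4 = override_on j2 i3 S"
  have j1: "j1 \<in> multi_indices n m" unfolding j1_def by (intro mi j)
  have i2: "i2 \<in> multi_indices n m" unfolding i2_def by (intro mi i j1)
  have j2: "j2 \<in> multi_indices n m" unfolding j2_def by (intro mi i j1)
  have i3: "i3 \<in> multi_indices n m" unfolding i3_def by (intro mi i2)
  have j4: "j4 \<in> multi_indices n m" unfolding j4_def by (intro mi i3 j2)
  have "T i * T j = T i * T j1" using sym[OF j] by (simp add: j1_def)
  also have "\<dots> = T i2 * T j2" using S i j1 by (simp add: exchangeable_def i2_def j2_def)
  also have "\<dots> = T i3 * T j2" using sym[OF i2] by (simp add: i3_def)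
  also have "\<dots> = T i4 * T j4" using S i3 j2 by (simp add: exchangeable_def i4_def j4_def)
  also have "\<dots> = T i4 * T (j4 \<circ> ?\<tau>)" using sym[OF j4] by simp
  finally have "T i * T j = T i4 * T (j4 \<circ> ?\<tau>)" .
  moreover have "i4 = override_on i j {q}" "j4 \<circ> ?\<tau> = override_on j i {q}"
    using pq(1,2)
    by (auto simp: i4_def j4_def i3_def i2_def j2_def j1_def fun_eq_iff override_on_def transpose_def)
  ultimately show "T i * T j = T (override_on i j {q}) * T (override_on j i {q})" by simp
qed

text \<open>First \<open>{q}\<close> is split off from \<open>S\<close>. Then \<open>{q}\<close>
  takes the role of \<open>S\<close>, with \<open>q\<close> as the inner mode, and this reaches
  every other \<open>k\<close> in \<open>B\<close>, whether inside or outside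
  \<open>S\<close>.\<close>

lemma exchangeable_singletons_block:
  assumes S: "exchangeable n m T S" and pq: "p \<in> B \<inter> S" "q \<in> B - S" and B: "B \<subseteq> {1..m}"
    and sym: "\<And>\<sigma> i. \<sigma> permutes B \<Longrightarrow> i \<in> multi_indices n m \<Longrightarrow> T (i \<circ> \<sigma>) = T i"
    and k: "k \<in> B"
  shows "exchangeable n m T {k}"
proof -
  have tr: "T (i \<circ> transpose x y) = T i"
    if "x \<in> B" "y \<in> B" "i \<in> multi_indices n m" for x y i
    using that by (intro sym permutes_swap_id)
  have q: "exchangeable n m T {q}"
    using S pq B by (intro exchangeable_singleton[of n m T S p] tr) auto
  show ?thesis
  proof (cases "k = q")
    case False
    then show ?thesis
      using q pq(2) k B by (intro exchangeable_singleton[of n m T "{q}" q k] tr) auto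
  qed (use q in simp)
qed

lemma exchangeable_matricization:
  assumes \<pi>: "\<pi> permutes {1..2 * d}" and rank: "mat_rank (matricization n d \<pi> T) \<le> 1"
  shows "exchangeable n (2 * d) T (\<pi> ` {1..d})"
  unfolding exchangeable_def
proof (intro ballI)
  let ?I = "multi_indices n (2 * d)" and ?M = "matricization n d \<pi> T"
  fix i j assume i: "i \<in> ?I" and j: "j \<in> ?I"
  define S where "S = \<pi> ` {1..d}"
  define row where "row i = lin_index n d (\<lambda>k. i (\<pi> k)) - 1" for i
  define col where "col i = lin_index n d (\<lambda>k. i (\<pi> (d + k))) - 1" for i
  have entry: "?M $$ (row i, col i) = T i" if "i \<in> ?I" for i
    unfolding row_def col_def by (rule matricization_entry[OF \<pi> that])
  have lt: "row i < n ^ d" "col i < n ^ d" if "i \<in> ?I" for i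
    using multi_index_lin_bounds[OF \<pi> that] by (auto simp: row_def col_def)
  have inj: "\<pi> x = \<pi> y \<longleftrightarrow> x = y" for x y
    using permutes_inj[OF \<pi>] by (auto dest: injD)
  \<comment> \<open>\<open>row\<close> reads only modes in \<open>S\<close> and \<open>col\<close>
    only modes outside it, so exchanging \<open>S\<close> exchanges the rows of the two entries and
    fixes their columns.\<close>
  have override: "row (override_on i j S) = row j" "col (override_on i j S) = col i" for i j
    by (auto simp: S_def row_def col_def lin_index_def override_on_def inj intro!: sum.cong)
  interpret vec_space "TYPE(complex)" "n ^ d" .
  have "?M $$ (row i, col i) * ?M $$ (row j, col j) = ?M $$ (row i, col j) * ?M $$ (row j, col i)"
    using rank lt[OF i] lt[OF j] matricization_carrier[of n d \<pi> T]
    by (intro rank_le_1_minor_eq[of _ "n ^ d"]) (auto simp: mat_rank_def matricization_def)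
  then have "T i * T j = T (override_on i j S) * T (override_on j i S)"
    using entry[OF i] entry[OF j] entry[OF override_on_multi_indices[OF i j, of S]]
      entry[OF override_on_multi_indices[OF j i, of S]]
    by (simp add: override mult.commute)
  then show "T i * T j
      = T (override_on i j (\<pi> ` {1..d})) * T (override_on j i (\<pi> ` {1..d}))"
    by (simp only: S_def)
qed

section \<open>Outer products\<close>

text \<open>Starting from \<open>j\<close>, the modes in \<open>K\<close> are changed one at a time.
  Exchanging mode \<open>k\<close> with \<open>j\<close> itself shows that each change multiplies
  the entry by a factor depending only on \<open>k\<close> and \<open>i k\<close>.\<close>

lemma entry_eq_prod_if_exchangeable:
  fixes T :: "(nat \<Rightarrow> nat) \<Rightarrow> 'a::field"
  assumes ex: "\<And>k. k \<in> K \<Longrightarrow> exchangeable n m T {k}" and "finite K"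
    and i: "i \<in> multi_indices n m" and j: "j \<in> multi_indices n m" and nz: "T j \<noteq> 0"
  shows "T (override_on j i K) = T j * (\<Prod>k\<in>K. T (j(k := i k)) / T j)"
  using assms(2) ex
proof (induction K rule: finite_induct)
  case (insert k K)
  let ?i = "override_on j i (insert k K)"
  have "T ?i * T j = T (override_on ?i j {k}) * T (override_on j ?i {k})"
    using insert.prems[of k] override_on_multi_indices[OF j i] j by (simp add: exchangeable_def)
  moreover have "override_on ?i j {k} = override_on j i K"
    using insert.hyps by (auto simp: fun_eq_iff override_on_def)
  moreover have "override_on j ?i {k} = j(k := i k)"
    by (auto simp: fun_eq_iff override_on_def)
  ultimately have "T ?i = T (override_on j i K) * (T (j(k := i k)) / T j)"
    using nz by (simp add: nonzero_eq_divide_eq)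
  moreover have "T (override_on j i K) = T j * (\<Prod>k\<in>K. T (j(k := i k)) / T j)"
    using insert.IH insert.prems by blast
  ultimately show ?case
    by (simp only: prod.insert[OF insert.hyps] mult_ac)
qed simp

lemma tensor_rank_eq_1_if_exchangeable:
  assumes T: "T \<in> tensor_space n m" and m: "m \<ge> 1"
    and ex: "\<And>k. k \<in> {1..m} \<Longrightarrow> exchangeable n m T {k}"
    and j: "j \<in> multi_indices n m" and nz: "T j \<noteq> 0"
  shows "tensor_rank n m T = 1"
  unfolding tensor_rank_def
proof (rule Least_equality)
  \<comment> \<open>The vector of mode \<open>k\<close> is the fibre of \<open>T\<close> through
    \<open>j\<close> in direction \<open>k\<close>, divided by \<open>T j\<close>. The leading
    scalar \<open>T j\<close> is absorbed into mode 1, which exists as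
    \<open>m \<ge> 1\<close>.\<close>
  define a :: "nat \<Rightarrow> nat \<Rightarrow> complex vec"
    where "a r k = vec n (\<lambda>l. (if k = 1 then T j else 1) * (T (j(k := l + 1)) / T j))" for r k
  have "T i = outer_product n m (a 1) i" if i: "i \<in> multi_indices n m" for i
  proof -
    have ib: "i k \<in> {1..n}" if "k \<in> {1..m}" for k
      using i that unfolding multi_indices_def by blast
    have "override_on j i {1..m} = i"
      using i j by (auto simp: fun_eq_iff override_on_def multi_indices_def PiE_iff extensional_def)
    then have "T i = T j * (\<Prod>k=1..m. T (j(k := i k)) / T j)"
      using entry_eq_prod_if_exchangeable[of "{1..m}" n m T i j] ex i j nz by simp
    also have "\<dots> = (\<Prod>k=1..m. if k = 1 then T j else 1) * (\<Prod>k=1..m. T (j(k := i k)) / T j)"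
      using m by simp
    also have "\<dots> = (\<Prod>k=1..m. (if k = 1 then T j else 1) * (T (j(k := i k)) / T j))"
      by (simp only: prod.distrib)
    also have "\<dots> = (\<Prod>k=1..m. a 1 k $ (i k - 1))"
    proof (intro prod.cong refl)
      fix k assume "k \<in> {1..m}"
      then have "i k - 1 < n" "i k - 1 + 1 = i k" using ib[of k] by auto
      then show "(if k = 1 then T j else 1) * (T (j(k := i k)) / T j) = a 1 k $ (i k - 1)"
        by (simp only: a_def index_vec)
    qed
    finally show ?thesis using i by (simp add: outer_product_def)
  qed
  then have "T = (\<lambda>i\<in>multi_indices n m. \<Sum>r=1..1. outer_product n m (a r) i)"
    using T unfolding tensor_space_def
    by (intro extensionalityI[of T "multi_indices n m"]) (auto simp: PiE_def)
  then show "is_sum_of_outer_products n m 1 T"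
    unfolding is_sum_of_outer_products_def by (intro exI[of _ a]) (auto simp: a_def)
next
  fix r assume "is_sum_of_outer_products n m r T"
  \<comment> \<open>For \<open>r = 0\<close> the empty sum would give
    \<open>T j = 0\<close>.\<close>
  then show "1 \<le> r"
    using j nz by (cases r) (auto simp: is_sum_of_outer_products_def)
qed

lemma matricization_eq_0:
  assumes "\<pi> permutes {1..2 * d}" and "\<And>i. i \<in> multi_indices n (2 * d) \<Longrightarrow> T i = 0"
  shows "matricization n d \<pi> T = 0\<^sub>m (n ^ d) (n ^ d)"
proof (rule matricization_unique[symmetric, OF assms(1)])
  fix i assume i: "i \<in> multi_indices n (2 * d)"
  have "lin_index n d (\<lambda>k. i (\<pi> k)) - 1 < n ^ d" "lin_index n d (\<lambda>k. i (\<pi> (d + k))) - 1 < n ^ d"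
    using multi_index_lin_bounds[OF assms(1) i] by auto
  then show "0\<^sub>m (n ^ d) (n ^ d) $$
      (lin_index n d (\<lambda>k. i (\<pi> k)) - 1, lin_index n d (\<lambda>k. i (\<pi> (d + k))) - 1) = T i"
    using assms(2)[OF i] by simp
qed simp

theorem theorem4p12:
  fixes n d :: nat
    and T :: "(nat \<Rightarrow> nat) \<Rightarrow> complex"
    and \<pi> :: "nat \<Rightarrow> nat"
  assumes "n \<ge> 1" and "d \<ge> 1"
    and "T \<in> tensor_space n (2 * d)"
    and "partial_symmetric n d T"
    and "\<pi> permutes {1..2 * d}"
    and "\<lfloor>real d / 2\<rfloor> \<le> int (card (\<pi> ` {1..d} \<inter> {1..d}))"
    and "int (card (\<pi> ` {1..d} \<inter> {1..d})) \<le> \<lceil>real d / 2\<rceil>"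
    and "mat_rank (matricization n d \<pi> T) = 1"
  shows "tensor_rank n (2 * d) T = 1"
proof -
  let ?A = "\<pi> ` {1..d}" and ?B1 = "{1..d}" and ?B2 = "{d + 1..2 * d}"
  \<comment> \<open>The zero tensor has a matricization of rank 0, so rank 1 provides a nonzero base
    entry.\<close>
  have "\<exists>j\<in>multi_indices n (2 * d). T j \<noteq> 0"
  proof (rule ccontr)
    assume "\<not> ?thesis"
    then have "matricization n d \<pi> T = 0\<^sub>m (n ^ d) (n ^ d)"
      using assms(5) by (intro matricization_eq_0) auto
    then show False using assms(8) by (simp add: mat_rank_def vec_space.rank_0I)
  qed
  then obtain j where j: "j \<in> multi_indices n (2 * d)" "T j \<noteq> 0" by blast
  have A: "exchangeable n (2 * d) T ?A"
    using assms(5,8) by (intro exchangeable_matricization) simp_all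
  have A_sub: "?A \<subseteq> {1..2 * d}"
    using image_mono[of "{1..d}" "{1..2 * d}" \<pi>] permutes_image[OF assms(5)] by simp
  have card_A: "card ?A = d"
    using permutes_inj_on[OF assms(5)] by (simp add: card_image)
  have "card ((?A \<inter> ?B1) \<union> (?A \<inter> ?B2)) = card (?A \<inter> ?B1) + card (?A \<inter> ?B2)"
    by (intro card_Un_disjoint) auto
  moreover have "{1..2 * d} = ?B1 \<union> ?B2" by auto
  then have "(?A \<inter> ?B1) \<union> (?A \<inter> ?B2) = ?A" using A_sub by blast
  ultimately have card_sum: "card (?A \<inter> ?B1) + card (?A \<inter> ?B2) = d" using card_A by simp
  have sing: "exchangeable n (2 * d) T {k}" if k: "k \<in> {1..2 * d}" for k
  proof (cases "d = 1")
    \<comment> \<open>Here the blocks have no two distinct modes to transpose, but \<open>?A\<close>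
      is itself a single mode and its complement is the other one.\<close>
    case True
    then have "?A = {1} \<or> ?A = {2}"
      using A_sub by auto
    moreover have "{1..2 * d} = {1, 2}" using True by auto
    moreover have "{k} = X \<or> {k} = {1, 2} - X" if "X = {1} \<or> X = {2}" "k \<in> {1, 2}" for X
      using that by auto
    ultimately have "{k} = ?A \<or> {k} = {1..2 * d} - ?A" using k by (simp only:)
    then show ?thesis using A exchangeable_complement[OF A] by presburger
  next
    case False
    then have "real d \<ge> 2" using assms(2) by simp
    \<comment> \<open>From \<open>d \<ge> 2\<close> follows
      \<open>1 \<le> d / 2 \<le> d - 1\<close>, so the first block has modes both inside and outside
      \<open>?A\<close>. By \<open>card_sum\<close> the same holds for the second block.\<close>
    then have "\<lfloor>real d / 2\<rfloor> \<ge> 1" "\<lceil>real d / 2\<rceil> \<le> int d - 1"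
      by (simp_all only: le_floor_iff ceiling_le_iff)
    then have a: "card (?A \<inter> ?B1) \<ge> 1" "card (?A \<inter> ?B1) < d"
      using assms(6,7) by linarith+
    have block: "exchangeable n (2 * d) T {k}"
      if B: "B \<subseteq> {1..2 * d}" "card B = d" "card (?A \<inter> B) \<ge> 1" "card (?A \<inter> B) < d" "k \<in> B"
        and sym: "\<And>\<sigma> i. \<sigma> permutes B \<Longrightarrow> i \<in> multi_indices n (2 * d) \<Longrightarrow> T (i \<circ> \<sigma>) = T i" for B
    proof -
      have "?A \<inter> B \<noteq> {}" using B(3) by force
      then obtain p where "p \<in> B \<inter> ?A" by blast
      moreover have "?A \<inter> B \<noteq> B" using B(2,4) by force
      then obtain q where "q \<in> B - ?A" by blast
      ultimately show ?thesis
        using exchangeable_singletons_block[OF A _ _ B(1) sym B(5)] by blast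
    qed
    have sym: "T (i \<circ> \<sigma>) = T i"
      if "\<sigma> permutes ?B1 \<or> \<sigma> permutes ?B2" "i \<in> multi_indices n (2 * d)" for \<sigma> i
      using assms(4) that unfolding partial_symmetric_def by blast
    show ?thesis
    proof (cases "k \<le> d")
      case True
      then show ?thesis
        using k a by (intro block[of ?B1] sym) simp_all
    next
      case False
      then show ?thesis
        using k a card_sum by (intro block[of ?B2] sym) auto
    qed
  qed
  show ?thesis
    using assms(2,3) sing j by (intro tensor_rank_eq_1_if_exchangeable) auto
qed

end
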